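(* Let $m\ge 0$ be an integer, let $K,K',M$ be edge-path connected simplicial complexes, and let $\varphi,\psi:K\to K'$ and $\mu:M\to K$ be simplicial maps. Then $\mathrm{SD}_m(\varphi\circ\mu,\psi\circ\mu)\le\mathrm{SD}_m(\varphi,\psi)$.
   Context: Simplicial complexes are abstract simplicial complexes. Simplicial maps $f,g:A\to B$ are contiguous, $f\sim_c g$, if for every simplex $\{v_0,\dots,v_k\}$ of $A$ the set $\{f(v_0),\dots,f(v_k),g(v_0),\dots,g(v_k)\}$ is a simplex of $B$. They are in the same contiguity class, $f\sim g$, if there is a finite sequence of simplicial maps $f=f_0\sim_c f_1\sim_c\dots\sim_c f_n=g$ from $A$ to $B$. For an integer $m\ge 0$ and simplicial maps $\varphi,\psi:A\to B$, the $m$-contiguity distance $\mathrm{SD}_m(\varphi,\psi)$ is the least integer $k\ge 0$ such that $A$ is covered by subcomplexes $A_0,\dots,A_k$ with the property that for each $j$ and every simplicial map $\eta:P\to A_j$ from an $m$-dimensional simplicial complex $P$, $\varphi\circ\eta\sim\psi\circ\eta$ ($\infty$ if no such cover exists). *)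

theory Defs
  imports Main "HOL-Library.Extended_Nat"
begin

text \<open>An abstract simplicial complex is given by its set of (nonempty) simplices. The vertex set
  is the union of the simplices, so every vertex spans a simplex.\<close>

definition simplicial_complex :: "'a set set \<Rightarrow> bool" where
  "simplicial_complex K \<longleftrightarrow>
     (\<forall>\<sigma>\<in>K. finite \<sigma> \<and> \<sigma> \<noteq> {}) \<and> (\<forall>\<sigma>\<in>K. \<forall>\<tau>. \<tau> \<subseteq> \<sigma> \<and> \<tau> \<noteq> {} \<longrightarrow> \<tau> \<in> K)"

definition vertices :: "'a set set \<Rightarrow> 'a set" where
  "vertices K = \<Union>K"

definition subcomplex :: "'a set set \<Rightarrow> 'a set set \<Rightarrow> bool" where
  "subcomplex L K \<longleftrightarrow> simplicial_complex L \<and> L \<subseteq> K"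

definition has_dimension :: "'a set set \<Rightarrow> nat \<Rightarrow> bool" where
  "has_dimension K m \<longleftrightarrow> (\<forall>\<sigma>\<in>K. card \<sigma> \<le> m + 1) \<and> (\<exists>\<sigma>\<in>K. card \<sigma> = m + 1)"

text \<open>Consecutive vertices of an edge path may coincide.\<close>

definition edge_path_connected :: "'a set set \<Rightarrow> bool" where
  "edge_path_connected K \<longleftrightarrow>
     (\<forall>u\<in>vertices K. \<forall>v\<in>vertices K. \<exists>n. \<exists>p :: nat \<Rightarrow> 'a.
        p 0 = u \<and> p n = v \<and> (\<forall>i<n. {p i, p (Suc i)} \<in> K))"

text \<open>A simplicial map is represented by a function on the whole vertex type. Its values off the
  vertices of the domain are irrelevant to all notions below; in particular, two simplicial maps
  that agree on the vertices of the domain are contiguous.\<close>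

definition simplicial_map :: "'a set set \<Rightarrow> 'b set set \<Rightarrow> ('a \<Rightarrow> 'b) \<Rightarrow> bool" where
  "simplicial_map A B f \<longleftrightarrow> (\<forall>\<sigma>\<in>A. f ` \<sigma> \<in> B)"

definition contiguous :: "'a set set \<Rightarrow> 'b set set \<Rightarrow> ('a \<Rightarrow> 'b) \<Rightarrow> ('a \<Rightarrow> 'b) \<Rightarrow> bool" where
  "contiguous A B f g \<longleftrightarrow> (\<forall>\<sigma>\<in>A. f ` \<sigma> \<union> g ` \<sigma> \<in> B)"

definition same_contiguity_class ::
    "'a set set \<Rightarrow> 'b set set \<Rightarrow> ('a \<Rightarrow> 'b) \<Rightarrow> ('a \<Rightarrow> 'b) \<Rightarrow> bool" where
  "same_contiguity_class A B f g \<longleftrightarrow>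
     (\<exists>n. \<exists>h :: nat \<Rightarrow> 'a \<Rightarrow> 'b. h 0 = f \<and> h n = g \<and>
        (\<forall>i\<le>n. simplicial_map A B (h i)) \<and>
        (\<forall>i<n. contiguous A B (h i) (h (Suc i))))"

text \<open>The condition imposed on each member \<open>A\<close> of a cover: all simplicial maps from an
  \<open>m\<close>-dimensional complex \<open>P\<close> into \<open>A\<close> equalise \<open>\<phi>\<close> and \<open>\<psi>\<close> up to contiguity class. HOL cannot
  quantify over the vertex type of \<open>P\<close> inside a definition. The type \<open>'a + nat\<close> is large enough
  for this to be no restriction, as lemma \<open>m_contiguous_any_type\<close> below shows.\<close>

definition m_contiguous_on ::
    "nat \<Rightarrow> 'a set set \<Rightarrow> 'b set set \<Rightarrow> ('a \<Rightarrow> 'b) \<Rightarrow> ('a \<Rightarrow> 'b) \<Rightarrow> bool" where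
  "m_contiguous_on m A B \<phi> \<psi> \<longleftrightarrow>
     (\<forall>(P :: ('a + nat) set set) \<eta>.
        simplicial_complex P \<and> has_dimension P m \<and> simplicial_map P A \<eta> \<longrightarrow>
        same_contiguity_class P B (\<phi> \<circ> \<eta>) (\<psi> \<circ> \<eta>))"

text \<open>The infimum of the empty set is \<open>\<infinity>\<close> in \<^typ>\<open>enat\<close>.\<close>

definition SD :: "nat \<Rightarrow> 'a set set \<Rightarrow> 'b set set \<Rightarrow> ('a \<Rightarrow> 'b) \<Rightarrow> ('a \<Rightarrow> 'b) \<Rightarrow> enat" where
  "SD m A B \<phi> \<psi> =
     Inf (enat ` {k. \<exists>C :: nat \<Rightarrow> 'a set set.
        (\<forall>j\<le>k. subcomplex (C j) A) \<and> A = (\<Union>j\<le>k. C j) \<and>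
        (\<forall>j\<le>k. m_contiguous_on m (C j) B \<phi> \<psi>)})"

lemma same_contiguity_class_comp:
  assumes "same_contiguity_class Q B f g" and "simplicial_map P Q h"
  shows "same_contiguity_class P B (f \<circ> h) (g \<circ> h)"
proof -
  obtain n H where H: "H 0 = f" "H n = g" "\<forall>i\<le>n. simplicial_map Q B (H i)"
      "\<forall>i<n. contiguous Q B (H i) (H (Suc i))"
    using assms(1) unfolding same_contiguity_class_def by blast
  have "simplicial_map P B (H i \<circ> h)" if "i \<le> n" for i
    using H(3) that assms(2) unfolding simplicial_map_def image_comp[symmetric] by blast
  moreover have "contiguous P B (H i \<circ> h) (H (Suc i) \<circ> h)" if "i < n" for i
    using H(4) that assms(2) unfolding simplicial_map_def contiguous_def image_comp[symmetric] by blast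
  ultimately show ?thesis
    unfolding same_contiguity_class_def
    by (intro exI[of _ n] exI[of _ "\<lambda>i. H i \<circ> h"]) (simp add: H(1,2))
qed

text \<open>A simplicial map from \<open>P\<close> to \<open>A\<close> factors through the \<open>m\<close>-skeleton of \<open>A\<close>; adding a disjoint
  \<open>m\<close>-simplex, mapped to a vertex of \<open>A\<close>, makes that skeleton exactly \<open>m\<close>-dimensional.\<close>

lemma m_contiguous_any_type:
  fixes P :: "'p set set" and A :: "'a set set"
  assumes A: "simplicial_complex A" and mc: "m_contiguous_on m A B \<phi> \<psi>"
    and P: "simplicial_complex P" "has_dimension P m" "simplicial_map P A \<eta>"
  shows "same_contiguity_class P B (\<phi> \<circ> \<eta>) (\<psi> \<circ> \<eta>)"
proof -
  obtain \<sigma>0 where "\<sigma>0 \<in> P" using P(2) by (auto simp: has_dimension_def)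
  then have \<eta>\<sigma>0: "\<eta> ` \<sigma>0 \<in> A" using P(3) by (simp add: simplicial_map_def)
  then obtain a where a: "a \<in> \<eta> ` \<sigma>0" using A unfolding simplicial_complex_def by (metis ex_in_conv)
  have aA: "{a} \<in> A"
    using A a \<eta>\<sigma>0 unfolding simplicial_complex_def by (metis empty_subsetI insert_subset insert_not_empty)
  define S where "S = {\<sigma> \<in> A. card \<sigma> \<le> m + 1}"
  define T where "T = {\<tau>. \<tau> \<subseteq> {..m} \<and> \<tau> \<noteq> {}}"
  define Q :: "('a + nat) set set" where "Q = image Inl ` S \<union> image Inr ` T"
  define \<epsilon> :: "'a + nat \<Rightarrow> 'a" where "\<epsilon> = case_sum id (\<lambda>_. a)"
  have S: "simplicial_complex S"
    using A unfolding simplicial_complex_def S_def by (auto dest: card_mono order_trans)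
  have T: "simplicial_complex T"
    unfolding simplicial_complex_def T_def by (auto intro: finite_subset)
  have Q: "simplicial_complex Q"
    unfolding simplicial_complex_def
  proof (intro conjI ballI allI impI)
    fix \<sigma> assume "\<sigma> \<in> Q"
    then show "finite \<sigma>" "\<sigma> \<noteq> {}"
      using S T by (auto simp: Q_def simplicial_complex_def)
  next
    fix \<sigma> \<tau> assume "\<sigma> \<in> Q" and \<tau>: "\<tau> \<subseteq> \<sigma> \<and> \<tau> \<noteq> {}"
    then consider \<rho> where "\<rho> \<in> S" "\<sigma> = Inl ` \<rho>" | \<rho> where "\<rho> \<in> T" "\<sigma> = Inr ` \<rho>"
      by (auto simp: Q_def)
    then show "\<tau> \<in> Q"
    proof cases
      case 1
      then obtain \<rho>' where "\<rho>' \<subseteq> \<rho>" "\<tau> = Inl ` \<rho>'" using \<tau> by (meson subset_imageE)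
      moreover from this have "\<rho>' \<in> S"
        using S 1(1) \<tau> unfolding simplicial_complex_def by (metis image_empty)
      ultimately show ?thesis unfolding Q_def by blast
    next
      case 2
      then obtain \<rho>' where "\<rho>' \<subseteq> \<rho>" "\<tau> = Inr ` \<rho>'" using \<tau> by (meson subset_imageE)
      moreover from this have "\<rho>' \<in> T"
        using T 2(1) \<tau> unfolding simplicial_complex_def by (metis image_empty)
      ultimately show ?thesis unfolding Q_def by blast
    qed
  qed
  have cT: "card \<tau> \<le> m + 1" if "\<tau> \<in> T" for \<tau>
    using that card_mono[of "{..m}" \<tau>] by (simp add: T_def)
  have "Inr ` {..m} \<in> Q" by (auto simp: Q_def T_def)
  moreover have "card (Inr ` {..m} :: ('a + nat) set) = m + 1" by (simp add: card_image)
  moreover have "\<forall>\<sigma>\<in>Q. card \<sigma> \<le> m + 1"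
    using cT by (auto simp: Q_def S_def card_image)
  ultimately have dim: "has_dimension Q m" unfolding has_dimension_def by blast
  have eL: "\<epsilon> ` Inl ` \<rho> = \<rho>" for \<rho> by (simp add: \<epsilon>_def image_image)
  have eR: "\<epsilon> ` Inr ` \<rho> = {a}" if "\<rho> \<noteq> {}" for \<rho>
    using that by (auto simp: \<epsilon>_def image_image)
  have e: "simplicial_map Q A \<epsilon>"
    unfolding simplicial_map_def
  proof
    fix \<sigma> assume "\<sigma> \<in> Q"
    then consider \<rho> where "\<rho> \<in> A" "\<sigma> = Inl ` \<rho>" | \<rho> where "\<rho> \<noteq> {}" "\<sigma> = Inr ` \<rho>"
      unfolding Q_def S_def T_def by blast
    then show "\<epsilon> ` \<sigma> \<in> A" using aA eL eR by cases simp_all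
  qed
  have h: "simplicial_map P Q (Inl \<circ> \<eta>)"
    unfolding simplicial_map_def
  proof
    fix \<sigma> assume s: "\<sigma> \<in> P"
    have "card (\<eta> ` \<sigma>) \<le> card \<sigma>" using s P(1) by (simp add: simplicial_complex_def card_image_le)
    also have "\<dots> \<le> m + 1" using s P(2) by (simp add: has_dimension_def)
    finally have "\<eta> ` \<sigma> \<in> S" using s P(3) by (simp add: S_def simplicial_map_def)
    then show "(Inl \<circ> \<eta>) ` \<sigma> \<in> Q" unfolding Q_def image_comp[symmetric] by blast
  qed
  have "same_contiguity_class Q B (\<phi> \<circ> \<epsilon>) (\<psi> \<circ> \<epsilon>)"
    using mc Q dim e by (simp add: m_contiguous_on_def)
  from same_contiguity_class_comp[OF this h]
  show ?thesis by (simp add: \<epsilon>_def comp_def)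
qed

end

theory Submission
  imports Defs
begin

text \<open>Covers pull back along \<open>\<mu>\<close>. Given a cover of \<open>K\<close> by
  subcomplexes \<open>C j\<close> admissible for \<open>\<phi>\<close> and \<open>\<psi>\<close>,
  the simplices of \<open>M\<close> that \<open>\<mu>\<close> sends into \<open>C j\<close> form
  subcomplexes \<open>D j\<close> covering \<open>M\<close>
  (\<open>simplicial_complex_preimage\<close>). A test map \<open>\<eta>\<close> into
  \<open>D j\<close> becomes the test map \<open>\<mu> \<circ> \<eta>\<close> into
  \<open>C j\<close>, so the pulled-back cover is admissible for the composites
  (\<open>m_contiguous_on_comp\<close>). It has the same number of members, hence the
  inequality.\<close>

lemma simplicial_complex_face:
  assumes "simplicial_complex K" and "\<sigma> \<in> K" and "\<tau> \<subseteq> \<sigma>" and "\<tau> \<noteq> {}"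
  shows "\<tau> \<in> K"
  using assms unfolding simplicial_complex_def by metis

lemma simplicial_complex_preimage:
  assumes "simplicial_complex M" and "simplicial_complex C"
  shows "simplicial_complex {\<sigma> \<in> M. \<mu> ` \<sigma> \<in> C}"
  unfolding simplicial_complex_def
proof (intro conjI ballI allI impI)
  fix \<sigma> assume "\<sigma> \<in> {\<sigma> \<in> M. \<mu> ` \<sigma> \<in> C}"
  then have "\<sigma> \<in> M" by simp
  with assms(1) show "finite \<sigma>" "\<sigma> \<noteq> {}" unfolding simplicial_complex_def by metis+
next
  fix \<sigma> \<tau> assume "\<sigma> \<in> {\<sigma> \<in> M. \<mu> ` \<sigma> \<in> C}" and \<tau>: "\<tau> \<subseteq> \<sigma> \<and> \<tau> \<noteq> {}"
  then have \<sigma>: "\<sigma> \<in> M" "\<mu> ` \<sigma> \<in> C" by simp_all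
  have "\<tau> \<in> M"
    by (rule simplicial_complex_face[OF assms(1) \<sigma>(1)]) (simp_all add: \<tau>)
  moreover have "\<mu> ` \<tau> \<in> C"
    by (rule simplicial_complex_face[OF assms(2) \<sigma>(2)]) (simp_all add: \<tau> image_mono)
  ultimately show "\<tau> \<in> {\<sigma> \<in> M. \<mu> ` \<sigma> \<in> C}" by simp
qed

text \<open>Composing with \<open>\<mu>\<close> turns a test map into \<open>D\<close> into a test
  map into \<open>A\<close> with the same source \<open>P\<close>; associativity of composition does
  the rest.\<close>

lemma m_contiguous_on_comp:
  assumes "simplicial_complex A" and "m_contiguous_on m A B \<phi> \<psi>" and "simplicial_map D A \<mu>"
  shows "m_contiguous_on m D B (\<phi> \<circ> \<mu>) (\<psi> \<circ> \<mu>)"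
  unfolding m_contiguous_on_def
proof (intro allI impI, elim conjE)
  fix P :: "('c + nat) set set" and \<eta>
  assume P: "simplicial_complex P" "has_dimension P m" and \<eta>: "simplicial_map P D \<eta>"
  have "simplicial_map P A (\<mu> \<circ> \<eta>)"
    using \<eta> assms(3) unfolding simplicial_map_def image_comp[symmetric] by blast
  \<comment> \<open>The vertices of \<open>P\<close> have type \<open>'c + nat\<close>, whereas the
    hypothesis on \<open>A\<close> only tests complexes over \<open>'a + nat\<close>; this lemma
    bridges the two types.\<close>
  from m_contiguous_any_type[OF assms(1,2) P this]
  show "same_contiguity_class P B (\<phi> \<circ> \<mu> \<circ> \<eta>) (\<psi> \<circ> \<mu> \<circ> \<eta>)"
    by (simp add: comp_assoc)
qed

theorem proposition3p3:
  fixes m :: nat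
    and K :: "'a set set" and K' :: "'b set set" and M :: "'c set set"
    and \<phi> \<psi> :: "'a \<Rightarrow> 'b" and \<mu> :: "'c \<Rightarrow> 'a"
  assumes "simplicial_complex K" and "edge_path_connected K"
    and "simplicial_complex K'" and "edge_path_connected K'"
    and "simplicial_complex M" and "edge_path_connected M"
    and "simplicial_map K K' \<phi>" and "simplicial_map K K' \<psi>"
    and "simplicial_map M K \<mu>"
  shows "SD m M K' (\<phi> \<circ> \<mu>) (\<psi> \<circ> \<mu>) \<le> SD m K K' \<phi> \<psi>"
  unfolding SD_def
\<comment> \<open>Both distances are infima, so it suffices that each \<open>k\<close> admissible
  for \<open>\<phi>\<close> and \<open>\<psi>\<close> is admissible for the composites. The case of
  an infinite right-hand side is included: its set is then empty.\<close>
proof (rule Inf_superset_mono, rule image_mono, rule Collect_mono, rule impI, elim exE conjE)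
  fix k and C :: "nat \<Rightarrow> 'a set set"
  assume C: "\<forall>j\<le>k. subcomplex (C j) K" "K = (\<Union>j\<le>k. C j)"
    and mc: "\<forall>j\<le>k. m_contiguous_on m (C j) K' \<phi> \<psi>"
  define D where "D j = {\<sigma> \<in> M. \<mu> ` \<sigma> \<in> C j}" for j
  have sub: "\<forall>j\<le>k. subcomplex (D j) M"
    using C(1) simplicial_complex_preimage[OF assms(5)]
    unfolding D_def subcomplex_def by blast
  have cover: "M = (\<Union>j\<le>k. D j)"
  proof
    show "M \<subseteq> (\<Union>j\<le>k. D j)"
    proof
      fix \<sigma> assume \<sigma>: "\<sigma> \<in> M"
      then have "\<mu> ` \<sigma> \<in> (\<Union>j\<le>k. C j)"
        using assms(9) unfolding C(2)[symmetric] simplicial_map_def by blast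
      then show "\<sigma> \<in> (\<Union>j\<le>k. D j)" using \<sigma> by (auto simp: D_def)
    qed
  qed (auto simp: D_def)
  have mcD: "\<forall>j\<le>k. m_contiguous_on m (D j) K' (\<phi> \<circ> \<mu>) (\<psi> \<circ> \<mu>)"
  proof (intro allI impI, rule m_contiguous_on_comp)
    fix j assume "j \<le> k"
    then show "simplicial_complex (C j)" "m_contiguous_on m (C j) K' \<phi> \<psi>"
      using C(1) mc by (simp_all add: subcomplex_def)
    show "simplicial_map (D j) (C j) \<mu>"
      by (simp add: D_def simplicial_map_def)
  qed
  show "\<exists>D :: nat \<Rightarrow> 'c set set. (\<forall>j\<le>k. subcomplex (D j) M) \<and> M = (\<Union>j\<le>k. D j) \<and>
      (\<forall>j\<le>k. m_contiguous_on m (D j) K' (\<phi> \<circ> \<mu>) (\<psi> \<circ> \<mu>))"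
    using sub cover mcD by (intro exI[of _ D] conjI)
qed

end
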